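(* Let $k, r, n$ be integers with $3 \le k < r < n$ satisfying $$\chi(n-r+k-1,k-1) + n - r + k - 1 \le n \le \binom{n-r+k-1}{k-1} + n - r + k - 1.$$ Then there exists a primitive uniquely $K_r^{(k)}$-saturated $k$-uniform hypergraph on $n$ vertices.
   Context: The Johnson graph $J(m,j)$ has vertex set $\binom{[m]}{j}$, two $j$-sets being adjacent iff they intersect in exactly $j-1$ elements; $\chi(m,j)$ denotes the chromatic number of $J(m,j)$. $K_r^{(k)}$ denotes the complete $k$-uniform hypergraph on $r$ vertices. A $k$-uniform hypergraph $H$ is uniquely $K_r^{(k)}$-saturated if $H$ contains no copy of $K_r^{(k)}$ (i.e., no $r$-set of vertices all of whose $k$-subsets are edges), and for every $k$-subset $S$ of $V(H)$ that is not an edge of $H$, the hypergraph $H+S$ contains exactly one copy of $K_r^{(k)}$. A vertex $v$ is dominating in $H$ if every $k$-subset of $V(H)$ containing $v$ is an edge of $H$. $H$ is primitive uniquely $K_r^{(k)}$-saturated if it is uniquely $K_r^{(k)}$-saturated and has no dominating vertex. *)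

theory Defs
  imports Main "HOL-Library.Ramsey"
begin

text \<open>Graphs are given by a vertex set and an adjacency relation. For a finite loopless graph
  the set of admissible numbers of colours is nonempty, so the minimum is attained.\<close>

definition proper_coloring :: "'a set \<Rightarrow> ('a \<Rightarrow> 'a \<Rightarrow> bool) \<Rightarrow> nat \<Rightarrow> ('a \<Rightarrow> nat) \<Rightarrow> bool" where
  "proper_coloring V adj c f \<longleftrightarrow>
     f \<in> V \<rightarrow> {..<c} \<and> (\<forall>u\<in>V. \<forall>v\<in>V. adj u v \<longrightarrow> f u \<noteq> f v)"

definition chromatic_number :: "'a set \<Rightarrow> ('a \<Rightarrow> 'a \<Rightarrow> bool) \<Rightarrow> nat" where
  "chromatic_number V adj = (LEAST c. \<exists>f. proper_coloring V adj c f)"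

definition johnson_vertices :: "nat \<Rightarrow> nat \<Rightarrow> nat set set" where
  "johnson_vertices m j = [{1..m}]\<^bsup>j\<^esup>"

text \<open>Writing the condition additively avoids truncated subtraction and makes the relation
  irreflexive on \<open>j\<close>-sets also for \<open>j = 0\<close>.\<close>

definition johnson_adj :: "nat \<Rightarrow> nat set \<Rightarrow> nat set \<Rightarrow> bool" where
  "johnson_adj j A B \<longleftrightarrow> card (A \<inter> B) + 1 = j"

definition johnson_chi :: "nat \<Rightarrow> nat \<Rightarrow> nat" where
  "johnson_chi m j = chromatic_number (johnson_vertices m j) (johnson_adj j)"

definition uniform_hypergraph :: "nat \<Rightarrow> 'a set \<Rightarrow> 'a set set \<Rightarrow> bool" where
  "uniform_hypergraph k V E \<longleftrightarrow> finite V \<and> E \<subseteq> [V]\<^bsup>k\<^esup>"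

text \<open>A copy of the complete \<open>k\<close>-uniform hypergraph on \<open>r\<close> vertices is identified with its vertex
  set.\<close>

definition complete_copies :: "nat \<Rightarrow> nat \<Rightarrow> 'a set \<Rightarrow> 'a set set \<Rightarrow> 'a set set" where
  "complete_copies k r V E = {R \<in> [V]\<^bsup>r\<^esup>. [R]\<^bsup>k\<^esup> \<subseteq> E}"

definition uniquely_saturated :: "nat \<Rightarrow> nat \<Rightarrow> 'a set \<Rightarrow> 'a set set \<Rightarrow> bool" where
  "uniquely_saturated k r V E \<longleftrightarrow>
     complete_copies k r V E = {} \<and>
     (\<forall>S \<in> [V]\<^bsup>k\<^esup> - E. \<exists>!R. R \<in> complete_copies k r V (insert S E))"

definition dominating :: "nat \<Rightarrow> 'a set \<Rightarrow> 'a set set \<Rightarrow> 'a \<Rightarrow> bool" where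
  "dominating k V E v \<longleftrightarrow> (\<forall>S \<in> [V]\<^bsup>k\<^esup>. v \<in> S \<longrightarrow> S \<in> E)"

definition primitive_uniquely_saturated :: "nat \<Rightarrow> nat \<Rightarrow> 'a set \<Rightarrow> 'a set set \<Rightarrow> bool" where
  "primitive_uniquely_saturated k r V E \<longleftrightarrow>
     uniquely_saturated k r V E \<and> \<not> (\<exists>v\<in>V. dominating k V E v)"

end

theory Submission
  imports Defs
begin

text \<open>Split the vertex set as \<open>M \<union> W\<close> with \<open>card M = n - r + k - 1\<close>, and colour the
  \<open>(k-1)\<close>-subsets of \<open>M\<close> properly (as vertices of the Johnson graph) using exactly the elements
  of \<open>W\<close> as colours; splitting colour classes shows that every number of colours between the
  chromatic number and the number of vertices is possible. The non-edges are the sets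
  \<open>A \<union> {c A}\<close>. The \<open>(k-1)\<close>-subsets of a set \<open>B\<close> that contain a fixed \<open>(k-2)\<close>-set form a clique,
  so they use \<open>card B - k + 2\<close> colours. Hence a complete set \<open>R\<close> misses so many elements of
  \<open>W\<close> that it has fewer than \<open>r\<close> elements. When \<open>A \<union> {c A}\<close> is added, the clique can
  still be chosen to avoid \<open>A\<close>, unless \<open>R \<inter> M = A\<close>, and then \<open>R = A \<union> W\<close>.\<close>

section \<open>Proper colourings with a prescribed number of colours\<close>

lemma proper_coloring_johnson_chi:
  obtains f where "proper_coloring (johnson_vertices m j) (johnson_adj j) (johnson_chi m j) f"
proof -
  let ?V = "johnson_vertices m j"
  have "finite ?V"
    unfolding johnson_vertices_def by (simp add: finite_imp_finite_nsets)
  then obtain h where h: "bij_betw h ?V {..<card ?V}"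
    using ex_bij_betw_finite_nat unfolding lessThan_atLeast0 by blast
  \<comment> \<open>A \<open>j\<close>-set meets itself in \<open>j\<close>, not
    \<open>j - 1\<close>, elements, so there are no loops and the injective numbering
    \<open>h\<close> is proper. Thus the \<open>LEAST\<close> ranges over a nonempty set.\<close>
  have "h A \<noteq> h B" if "A \<in> ?V" "B \<in> ?V" "johnson_adj j A B" for A B
  proof -
    have "card A = j"
      using that(1) by (simp add: johnson_vertices_def nsets_def)
    then have "A \<noteq> B"
      using that(3) by (metis Int_absorb add_eq_self_zero johnson_adj_def zero_neq_one)
    then show ?thesis
      using that(1,2) bij_betw_imp_inj_on[OF h] by (blast dest: inj_onD)
  qed
  then have "proper_coloring ?V (johnson_adj j) (card ?V) h"
    using bij_betw_imp_funcset[OF h] unfolding proper_coloring_def by blast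
  then have "\<exists>f. proper_coloring ?V (johnson_adj j) (johnson_chi m j) f"
    unfolding johnson_chi_def chromatic_number_def by (intro LeastI) blast
  then show ?thesis using that by blast
qed

text \<open>While there are fewer colours than vertices, two vertices share a colour. Giving one of
  them a fresh colour adds exactly one colour and creates no conflict.\<close>

lemma recolor_card_image:
  fixes f :: "'a \<Rightarrow> nat"
  assumes "finite V" and proper: "\<forall>u\<in>V. \<forall>v\<in>V. adj u v \<longrightarrow> f u \<noteq> f v"
    and "card (f ` V) \<le> t" and "t \<le> card V"
  shows "\<exists>g :: 'a \<Rightarrow> nat. card (g ` V) = t \<and> (\<forall>u\<in>V. \<forall>v\<in>V. adj u v \<longrightarrow> g u \<noteq> g v)"
  using assms(3,4)
proof (induction t rule: dec_induct)
  case base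
  then show ?case using proper by blast
next
  case (step t)
  then obtain g :: "'a \<Rightarrow> nat"
    where g: "card (g ` V) = t" "\<forall>u\<in>V. \<forall>v\<in>V. adj u v \<longrightarrow> g u \<noteq> g v"
    by auto
  have "\<not> inj_on g V"
    using g(1) step.prems card_image by fastforce
  then obtain x y where xy: "x \<in> V" "y \<in> V" "x \<noteq> y" "g x = g y"
    by (auto simp: inj_on_def)
  obtain z where z: "z \<notin> g ` V"
    using ex_new_if_finite[of "g ` V"] \<open>finite V\<close> infinite_UNIV_nat by blast
  let ?g = "g(x := z)"
  \<comment> \<open>No old colour is lost: \<open>y\<close> still carries the former colour of
    \<open>x\<close>.\<close>
  have "?g ` V = insert z (g ` V)"
    using xy by (auto simp: image_iff)
  then have "card (?g ` V) = Suc t"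
    using z g(1) \<open>finite V\<close> by simp
  moreover have "\<forall>u\<in>V. \<forall>v\<in>V. adj u v \<longrightarrow> ?g u \<noteq> ?g v"
  proof (intro ballI impI)
    fix u v assume uv: "u \<in> V" "v \<in> V" "adj u v"
    then have "u \<noteq> v" using g(2) by blast
    then show "?g u \<noteq> ?g v"
      using uv g(2) z by (auto simp: image_iff)
  qed
  ultimately show ?case by blast
qed

section \<open>Counting colours outside a complete set\<close>

text \<open>Two distinct \<open>j\<close>-sets through \<open>D\<close> meet exactly in
  \<open>D\<close>, which has \<open>j - 1\<close> elements, so these sets form a clique.\<close>

lemma card_star_colors:
  fixes c :: "nat set \<Rightarrow> 'b"
  assumes proper: "\<forall>A\<in>[M]\<^bsup>j\<^esup>. \<forall>B\<in>[M]\<^bsup>j\<^esup>. johnson_adj j A B \<longrightarrow> c A \<noteq> c B"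
    and "B \<subseteq> M" and "D \<subseteq> B" and "finite D" and "card D + 1 = j"
  shows "card ((\<lambda>x. c (insert x D)) ` (B - D)) = card (B - D)"
proof (intro card_image inj_onI)
  fix x y assume x: "x \<in> B - D" and y: "y \<in> B - D" and eq: "c (insert x D) = c (insert y D)"
  show "x = y"
  proof (rule ccontr)
    assume "x \<noteq> y"
    then have "insert x D \<inter> insert y D = D"
      using x y by auto
    then have "johnson_adj j (insert x D) (insert y D)"
      using assms by (simp add: johnson_adj_def)
    moreover have "insert x D \<in> [M]\<^bsup>j\<^esup>" "insert y D \<in> [M]\<^bsup>j\<^esup>"
      using x y assms by (auto simp: nsets_def)
    ultimately show False
      using proper eq by blast
  qed
qed

text \<open>The assumption \<open>avoid\<close> says that \<open>R\<close> contains no non-edge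
  except possibly the one coming from \<open>A\<close>. This form serves both the original
  hypergraph and the one with that non-edge added.\<close>

lemma almost_complete_set_unique:
  fixes M W :: "nat set"
  assumes "finite M" and "finite W" and "M \<inter> W = {}" and "2 \<le> j"
    and proper: "\<forall>A\<in>[M]\<^bsup>j\<^esup>. \<forall>B\<in>[M]\<^bsup>j\<^esup>. johnson_adj j A B \<longrightarrow> c A \<noteq> c B"
    and c: "c \<in> [M]\<^bsup>j\<^esup> \<rightarrow> W"
    and A: "A \<in> [M]\<^bsup>j\<^esup>" and R: "R \<in> [M \<union> W]\<^bsup>(j + card W)\<^esup>"
    and avoid: "\<And>A'. \<lbrakk>A' \<in> [R \<inter> M]\<^bsup>j\<^esup>; A' \<noteq> A\<rbrakk> \<Longrightarrow> c A' \<notin> R"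
  shows "R = A \<union> W"
proof -
  define B where "B = R \<inter> M"
  have finB: "finite B" and BM: "B \<subseteq> M"
    using \<open>finite M\<close> by (auto simp: B_def)
  have cardA: "card A = j" and AM: "A \<subseteq> M" and finA: "finite A"
    using A by (auto simp: nsets_def)
  have R_split: "R = B \<union> (R \<inter> W)" "B \<inter> (R \<inter> W) = {}"
    using R \<open>M \<inter> W = {}\<close> by (auto simp: nsets_def B_def)
  have card_split: "card B + card (R \<inter> W) = j + card W"
    using card_Un_disjoint[of B "R \<inter> W"] R_split finB \<open>finite W\<close> R by (auto simp: nsets_def)
  have "B = A"
  proof (rule ccontr)
    assume "B \<noteq> A"
    have "j \<le> card B"
      using card_split card_mono[OF \<open>finite W\<close>, of "R \<inter> W"] by auto
    then have "\<not> B \<subseteq> A"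
      using \<open>B \<noteq> A\<close> cardA finA card_seteq by metis
    then obtain x where x: "x \<in> B" "x \<notin> A" by blast
    have "j - 2 \<le> card (B - {x})"
      using x finB \<open>j \<le> card B\<close> by simp
    then obtain D' where D': "D' \<subseteq> B - {x}" "card D' = j - 2" "finite D'"
      by (rule obtain_subset_with_card_n)
    \<comment> \<open>The element \<open>x\<close> outside \<open>A\<close> keeps \<open>A\<close>
      out of the clique through \<open>D\<close>, so every colour of this clique is missing from
      \<open>R\<close>.\<close>
    define D where "D = insert x D'"
    have D: "D \<subseteq> B" "finite D" "card D + 1 = j"
      using D' x \<open>2 \<le> j\<close> by (auto simp: D_def card_insert_if)
    define C where "C = (\<lambda>y. c (insert y D)) ` (B - D)"
    have "card C = card (B - D)"
      unfolding C_def using card_star_colors[OF proper BM D] .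
    then have "card C + j = card B + 1"
      using D finB card_mono[OF finB D(1)] by (simp add: card_Diff_subset)
    moreover have "C \<subseteq> W - R"
    proof
      fix w assume "w \<in> C"
      then obtain y where y: "y \<in> B" "y \<notin> D" "w = c (insert y D)"
        by (auto simp: C_def)
      have in_B: "insert y D \<in> [B]\<^bsup>j\<^esup>"
        using y D by (auto simp: nsets_def)
      moreover have "insert y D \<noteq> A"
        using x by (auto simp: D_def)
      ultimately have "w \<notin> R"
        using avoid y by (auto simp: B_def)
      moreover have "insert y D \<in> [M]\<^bsup>j\<^esup>"
        using in_B BM by (auto simp: nsets_def)
      ultimately show "w \<in> W - R"
        using c y by auto
    qed
    moreover have "card (W - R) + card (R \<inter> W) = card W"
      using card_Int_Diff[OF \<open>finite W\<close>, of R] by (simp add: Int_commute)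
    moreover have "card C \<le> card (W - R)"
      using \<open>C \<subseteq> W - R\<close> \<open>finite W\<close> by (simp add: card_mono)
    \<comment> \<open>The size of \<open>R\<close> leaves only \<open>card B - j\<close> elements in
      \<open>W - R\<close>, one fewer than \<open>C\<close> has.\<close>
    ultimately show False
      using card_split by linarith
  qed
  then have "R \<inter> W = W"
    using card_split cardA \<open>finite W\<close> by (intro card_subset_eq) auto
  then show ?thesis
    using R_split \<open>B = A\<close> by simp
qed

section \<open>The hypergraph defined by a colouring\<close>

lemma primitive_uniquely_saturated_of_coloring:
  fixes M W :: "nat set"
  assumes "finite M" and "finite W" and disj: "M \<inter> W = {}" and "2 \<le> j" and "j \<le> card M"
    and proper: "\<forall>A\<in>[M]\<^bsup>j\<^esup>. \<forall>B\<in>[M]\<^bsup>j\<^esup>. johnson_adj j A B \<longrightarrow> c A \<noteq> c B"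
    and onto: "c ` [M]\<^bsup>j\<^esup> = W"
  defines "N \<equiv> (\<lambda>A. insert (c A) A) ` [M]\<^bsup>j\<^esup>"
  shows "primitive_uniquely_saturated (j + 1) (j + card W) (M \<union> W) ([M \<union> W]\<^bsup>(j + 1)\<^esup> - N)"
proof -
  let ?V = "M \<union> W" and ?E = "[M \<union> W]\<^bsup>(j + 1)\<^esup> - N"
  have c: "c \<in> [M]\<^bsup>j\<^esup> \<rightarrow> W" using onto by auto
  \<comment> \<open>A non-edge determines its \<open>j\<close>-set as its trace on \<open>M\<close>,
    so different \<open>j\<close>-sets give different non-edges.\<close>
  have Int_M: "insert (c A) A \<inter> M = A" if "A \<in> [M]\<^bsup>j\<^esup>" for A
    using that c disj by (auto simp: nsets_def Pi_iff)
  have N_sub: "insert (c A) A \<in> [?V]\<^bsup>(j + 1)\<^esup>" if "A \<in> [M]\<^bsup>j\<^esup>" for A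
  proof -
    have "c A \<in> W" using that c by auto
    moreover have "A \<subseteq> M" "finite A" "card A = j" using that by (auto simp: nsets_def)
    moreover have "c A \<notin> A" using calculation disj by auto
    ultimately show ?thesis by (auto simp: nsets_def)
  qed
  have unique: "R = A \<union> W"
    if A: "A \<in> [M]\<^bsup>j\<^esup>"
      and R: "R \<in> complete_copies (j + 1) (j + card W) ?V (insert (insert (c A) A) ?E)" for A R
  proof (rule almost_complete_set_unique[OF assms(1-4) proper c A])
    show "R \<in> [?V]\<^bsup>(j + card W)\<^esup>"
      using R by (simp add: complete_copies_def)
    fix A' assume A': "A' \<in> [R \<inter> M]\<^bsup>j\<^esup>" "A' \<noteq> A"
    then have A'M: "A' \<in> [M]\<^bsup>j\<^esup>" by (auto simp: nsets_def)
    show "c A' \<notin> R"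
    proof
      assume "c A' \<in> R"
      then have "insert (c A') A' \<in> [R]\<^bsup>(j + 1)\<^esup>"
        using A' N_sub[OF A'M] by (auto simp: nsets_def)
      then have "insert (c A') A' \<in> insert (insert (c A) A) ?E"
        using R by (auto simp: complete_copies_def)
      moreover have "insert (c A') A' \<in> N"
        using A'M by (simp add: N_def)
      ultimately have "insert (c A') A' = insert (c A) A" by blast
      then show False
        using Int_M[OF A] Int_M[OF A'M] A'(2) by metis
    qed
  qed
  have copy: "A \<union> W \<in> complete_copies (j + 1) (j + card W) ?V (insert (insert (c A) A) ?E)"
    if A: "A \<in> [M]\<^bsup>j\<^esup>" for A
  proof -
    have A': "A \<subseteq> M" "finite A" "card A = j" using A by (auto simp: nsets_def)
    then have "card (A \<union> W) = j + card W"
      using card_Un_disjoint[of A W] \<open>finite W\<close> disj by auto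
    then have "A \<union> W \<in> [?V]\<^bsup>(j + card W)\<^esup>"
      using A' \<open>finite W\<close> by (auto simp: nsets_def)
    moreover have "K \<in> insert (insert (c A) A) ?E" if K: "K \<in> [A \<union> W]\<^bsup>(j + 1)\<^esup>" for K
    proof -
      have "K = insert (c A) A" if "K \<in> N"
      proof -
        obtain A1 where A1: "A1 \<in> [M]\<^bsup>j\<^esup>" "K = insert (c A1) A1"
          using \<open>K \<in> N\<close> by (auto simp: N_def)
        \<comment> \<open>Since \<open>A1\<close> lies in \<open>M\<close>, it misses
          \<open>W\<close>; having the size of \<open>A\<close>, it must then equal
          \<open>A\<close>.\<close>
        have "A1 \<subseteq> A"
          using K A1 disj by (auto simp: nsets_def)
        then have "A1 = A"
          using A1 A' by (intro card_subset_eq) (auto simp: nsets_def)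
        then show ?thesis using A1 by simp
      qed
      moreover have "K \<in> [?V]\<^bsup>(j + 1)\<^esup>"
        using K A' by (auto simp: nsets_def)
      ultimately show ?thesis by blast
    qed
    ultimately show ?thesis
      by (auto simp: complete_copies_def)
  qed
  have no_copy: "complete_copies (j + 1) (j + card W) ?V ?E = {}"
  proof (rule equals0I)
    fix R assume R: "R \<in> complete_copies (j + 1) (j + card W) ?V ?E"
    obtain A where A: "A \<in> [M]\<^bsup>j\<^esup>"
      using \<open>j \<le> card M\<close> obtain_subset_with_card_n[of j M] by (auto simp: nsets_def)
    \<comment> \<open>A copy survives the addition of a non-edge, so \<open>unique\<close> applies
      to it; but \<open>A \<union> W\<close> contains the non-edge of \<open>A\<close>.\<close>
    have "R = A \<union> W"
      using R by (intro unique[OF A]) (auto simp: complete_copies_def)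
    then have "insert (c A) A \<in> [R]\<^bsup>(j + 1)\<^esup>"
      using N_sub[OF A] A c by (auto simp: nsets_def)
    then have "insert (c A) A \<notin> N"
      using R by (auto simp: complete_copies_def)
    then show False using A by (simp add: N_def)
  qed
  have "\<exists>!R. R \<in> complete_copies (j + 1) (j + card W) ?V (insert S ?E)"
    if "S \<in> [?V]\<^bsup>(j + 1)\<^esup> - ?E" for S
  proof -
    have "S \<in> N" using that by blast
    then obtain A where "A \<in> [M]\<^bsup>j\<^esup>" "S = insert (c A) A"
      by (auto simp: N_def)
    then show ?thesis using unique copy by blast
  qed
  moreover have "\<not> dominating (j + 1) ?V ?E v" if v: "v \<in> ?V" for v
  proof -
    obtain A where A: "A \<in> [M]\<^bsup>j\<^esup>" "v \<in> insert (c A) A"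
    proof (cases "v \<in> M")
      case True
      have "j - 1 \<le> card (M - {v})"
        using True \<open>finite M\<close> \<open>j \<le> card M\<close> by simp
      then obtain D where D: "D \<subseteq> M - {v}" "card D = j - 1" "finite D"
        by (rule obtain_subset_with_card_n)
      then have "insert v D \<in> [M]\<^bsup>j\<^esup>"
        using True \<open>2 \<le> j\<close> by (auto simp: nsets_def card_insert_if)
      then show ?thesis using that by blast
    next
      case False
      \<comment> \<open>Every element of \<open>W\<close> is actually used as a colour, hence lies
        in a non-edge.\<close>
      then show ?thesis using v onto that by blast
    qed
    then have "insert (c A) A \<notin> ?E" by (simp add: N_def)
    then show ?thesis
      using A N_sub by (auto simp: dominating_def)
  qed
  ultimately show ?thesis
    using no_copy by (simp add: primitive_uniquely_saturated_def uniquely_saturated_def)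
qed

section \<open>Choice of the parameters\<close>

theorem theorem7:
  fixes k r n :: nat
  assumes "3 \<le> k" and "k < r" and "r < n"
    and "johnson_chi (n - r + k - 1) (k - 1) + (n - r + k - 1) \<le> n"
    and "n \<le> ((n - r + k - 1) choose (k - 1)) + (n - r + k - 1)"
  shows "\<exists>(V :: nat set) E. uniform_hypergraph k V E \<and> card V = n \<and>
           primitive_uniquely_saturated k r V E"
proof -
  define m where "m = n - r + k - 1"
  define j where "j = k - 1"
  define t where "t = n - m"
  define W where "W = {m + 1..n}"
  \<comment> \<open>The number of colours is \<open>t = r - k + 1\<close>, which makes
    \<open>A \<union> W\<close> have size \<open>r\<close>. From \<open>r < n\<close> comes
    \<open>k \<le> m\<close>, hence \<open>j \<le> m\<close>.\<close>
  have kj: "k = j + 1" and j: "2 \<le> j" "j \<le> m" and r: "r = j + t" and n: "n = m + t"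
    using assms(1-3) by (auto simp: m_def j_def t_def)
  have chi: "johnson_chi m j \<le> t" and t: "t \<le> m choose j"
    using assms(4,5)[folded m_def j_def] n by simp_all
  let ?J = "[{1..m}]\<^bsup>j\<^esup>"
  have fin: "finite ?J" by (simp add: finite_imp_finite_nsets)
  obtain f where f: "proper_coloring ?J (johnson_adj j) (johnson_chi m j) f"
    using proper_coloring_johnson_chi unfolding johnson_vertices_def by blast
  have "card (f ` ?J) \<le> johnson_chi m j"
    using f card_mono[of "{..<johnson_chi m j}" "f ` ?J"] by (auto simp: proper_coloring_def)
  then have "card (f ` ?J) \<le> t" using chi by simp
  moreover have "t \<le> card ?J" using t by simp
  moreover have "\<forall>A\<in>?J. \<forall>B\<in>?J. johnson_adj j A B \<longrightarrow> f A \<noteq> f B"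
    using f by (simp add: proper_coloring_def)
  ultimately obtain g :: "nat set \<Rightarrow> nat"
    where g: "card (g ` ?J) = t" "\<forall>A\<in>?J. \<forall>B\<in>?J. johnson_adj j A B \<longrightarrow> g A \<noteq> g B"
    using recolor_card_image[OF fin] by blast
  have cardW: "card W = t" by (simp add: W_def n)
  \<comment> \<open>Renaming the colours by \<open>h\<close> turns the colour set into
    \<open>W\<close>, disjoint from \<open>{1..m}\<close>; injectivity of \<open>h\<close> keeps the
    colouring proper.\<close>
  obtain h where h: "bij_betw h (g ` ?J) W"
    using finite_same_card_bij[of "g ` ?J" W] fin g(1) cardW by (auto simp: W_def)
  have onto: "(h \<circ> g) ` ?J = W"
    using h by (simp add: bij_betw_def image_comp)
  have "inj_on h (g ` ?J)"
    using h by (simp add: bij_betw_def)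
  then have proper: "\<forall>A\<in>?J. \<forall>B\<in>?J. johnson_adj j A B \<longrightarrow> (h \<circ> g) A \<noteq> (h \<circ> g) B"
    using g(2) by (simp add: inj_on_eq_iff)
  define N where "N = (\<lambda>A. insert ((h \<circ> g) A) A) ` ?J"
  have "primitive_uniquely_saturated (j + 1) (j + card W) ({1..m} \<union> W)
          ([{1..m} \<union> W]\<^bsup>(j + 1)\<^esup> - N)"
    unfolding N_def
    by (rule primitive_uniquely_saturated_of_coloring[OF _ _ _ _ _ proper onto])
      (use j in \<open>auto simp: W_def\<close>)
  moreover have "{1..m} \<union> W = {1..n}"
    using n by (auto simp: W_def)
  ultimately have "primitive_uniquely_saturated k r {1..n} ([{1..n}]\<^bsup>k\<^esup> - N)"
    using cardW by (simp add: kj r)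
  then show ?thesis
    by (intro exI[of _ "{1..n}"] exI[of _ "[{1..n}]\<^bsup>k\<^esup> - N"]) (simp add: uniform_hypergraph_def)
qed

end
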